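(* Let $k$ be an algebraically closed field and suppose that $a \in k^*$ is an element of infinite multiplicative order. Let $\sigma$ and $\sigma_a$ be the $k$-automorphisms of order two of the rational function field $k(x) = k(\mathbb{P}^1)$ given by $\sigma : x \mapsto 1/x$ and $\sigma_a : x \mapsto a/x$. Then the fixed fields $k(x)^{\sigma}$ and $k(x)^{\sigma_a}$ each have index $2$ in $k(x)$ (that is, $[k(x):k(x)^{\sigma}] = [k(x):k(x)^{\sigma_a}] = 2$), and $$k(x)^{\sigma} \cap k(x)^{\sigma_a} = k.$$
   Context: For an automorphism $\tau$ of $k(x)$, $k(x)^{\tau}$ denotes the subfield of elements fixed by $\tau$. *)

theory Defs
  imports "HOL-Computational_Algebra.Computational_Algebra" "HOL-Algebra.Algebraic_Closure_Type"
begin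

type_synonym 'k ratfun = "'k poly fract"

definition ratfun_const :: "'k::field \<Rightarrow> 'k ratfun" where
  "ratfun_const c = to_fract [:c:]"

definition ratfun_X :: "'k::field ratfun" where
  "ratfun_X = to_fract [:0, 1:]"

abbreviation ratfun_ring :: "'k::field ratfun ring" where
  "ratfun_ring \<equiv> ring_of_type_algebra"

definition ratfun_automorphism :: "('k::field ratfun \<Rightarrow> 'k ratfun) \<Rightarrow> bool" where
  "ratfun_automorphism \<tau> \<longleftrightarrow>
     \<tau> \<in> ring_iso ratfun_ring ratfun_ring \<and> (\<forall>c. \<tau> (ratfun_const c) = ratfun_const c)"

definition fixed_field :: "('k::field ratfun \<Rightarrow> 'k ratfun) \<Rightarrow> 'k ratfun set" where
  "fixed_field \<tau> = {f. \<tau> f = f}"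


text \<open>
  For every \<open>c \<noteq> 0\<close> there is exactly one \<open>k\<close>-automorphism sending \<open>x\<close> to \<open>c/x\<close>, so a statement
  about all such automorphisms is a statement about this one. Fixed sets are subfields,
  as the library's dimension predicate presupposes.
\<close>

lemma ratfun_const_hom [simp]:
  "ratfun_const (c + d) = ratfun_const c + ratfun_const d"
  "ratfun_const (c * d) = ratfun_const c * ratfun_const d"
  "ratfun_const 0 = 0" "ratfun_const 1 = 1"
  "ratfun_const c = 0 \<longleftrightarrow> c = 0"
proof -
  show "ratfun_const (c + d) = ratfun_const c + ratfun_const d"
    by (simp add: ratfun_const_def flip: to_fract_add)
  show "ratfun_const (c * d) = ratfun_const c * ratfun_const d"
    by (simp add: ratfun_const_def flip: to_fract_mult)
  show "ratfun_const 0 = 0" "ratfun_const 1 = 1"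
    by (simp_all add: ratfun_const_def flip: one_pCons)
  show "ratfun_const c = 0 \<longleftrightarrow> c = 0"
    by (simp add: ratfun_const_def)
qed

lemma ratfun_X_nonzero [simp]: "ratfun_X \<noteq> 0"
  by (simp add: ratfun_X_def)

lemma ratfun_poly_pCons:
  "poly (map_poly ratfun_const (pCons c p)) g = ratfun_const c + g * poly (map_poly ratfun_const p) g"
  by (simp add: map_poly_pCons)

lemma ratfun_poly_add:
  "poly (map_poly ratfun_const (p + q)) g
     = poly (map_poly ratfun_const p) g + poly (map_poly ratfun_const q) g"
proof -
  have "map_poly ratfun_const (p + q) = map_poly ratfun_const p + map_poly ratfun_const q"
    by (intro poly_eqI) (simp add: coeff_map_poly)
  thus ?thesis by simp
qed

lemma ratfun_poly_mult:
  "poly (map_poly ratfun_const (p * q)) g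
     = poly (map_poly ratfun_const p) g * poly (map_poly ratfun_const q) g"
proof (induction p)
  case 0
  show ?case by simp
next
  case (pCons c p)
  have "map_poly ratfun_const (smult c q) = smult (ratfun_const c) (map_poly ratfun_const q)"
    by (intro poly_eqI) (simp add: coeff_map_poly)
  thus ?case
    using pCons by (simp add: ratfun_poly_add ratfun_poly_pCons algebra_simps)
qed

lemma ratfun_poly_scaled_X:
  "poly (map_poly ratfun_const p) (ratfun_const c * ratfun_X) = to_fract (pcompose p [:0, c:])"
proof (induction p)
  case 0
  show ?case by simp
next
  case (pCons d p)
  have cX: "ratfun_const c * ratfun_X = to_fract [:0, c:]"
    by (simp add: ratfun_const_def ratfun_X_def flip: to_fract_mult)
  have "poly (map_poly ratfun_const (pCons d p)) (ratfun_const c * ratfun_X)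
      = to_fract [:d:] + to_fract [:0, c:] * to_fract (pcompose p [:0, c:])"
    by (simp only: ratfun_poly_pCons pCons.IH, simp only: cX, simp only: ratfun_const_def)
  also have "\<dots> = to_fract (pcompose (pCons d p) [:0, c:])"
    by (simp only: pcompose_pCons to_fract_add to_fract_mult)
  finally show ?case .
qed

lemma ratfun_poly_X: "poly (map_poly ratfun_const p) ratfun_X = to_fract p"
  using ratfun_poly_scaled_X[of p 1] by (simp add: pcompose_idR)

lemma ratfun_poly_inverse_X_nonzero:
  fixes p :: "'k::field poly"
  assumes "c \<noteq> 0" "p \<noteq> 0"
  shows "poly (map_poly ratfun_const p) (ratfun_const c / ratfun_X) \<noteq> 0"
proof
  define g :: "'k ratfun" where "g = ratfun_const c / ratfun_X"
  define P where "P = map_poly ratfun_const p"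
  assume "poly (map_poly ratfun_const p) (ratfun_const c / ratfun_X) = 0"
  hence 0: "poly P g = 0" by (simp add: P_def g_def)
  have g: "g \<noteq> 0" using assms by (simp add: g_def)
  have inv: "inverse g = ratfun_const (inverse c) * ratfun_X"
  proof -
    have "ratfun_const c * ratfun_const (inverse c) = 1"
      using assms by (simp flip: ratfun_const_hom(2))
    hence "inverse (ratfun_const c) = ratfun_const (inverse c)"
      by (rule inverse_unique)
    thus ?thesis by (simp add: g_def divide_inverse mult.commute)
  qed
  have refl: "reflect_poly P = map_poly ratfun_const (reflect_poly p)"
    by (intro poly_eqI) (simp add: P_def coeff_reflect_poly coeff_map_poly degree_map_poly)
  have "poly (reflect_poly P) (inverse g) = 0"
    using 0 g by (simp add: poly_reflect_poly_nz)
  hence "pcompose (reflect_poly p) [:0, inverse c:] = 0"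
    by (simp add: refl inv ratfun_poly_scaled_X)
  thus False
    using assms by (subst (asm) pcompose_eq_0_iff) auto
qed

lemma ratfun_automorphismD:
  assumes "ratfun_automorphism \<tau>"
  shows "\<tau> (f + g) = \<tau> f + \<tau> g" "\<tau> (f * g) = \<tau> f * \<tau> g" "\<tau> 0 = 0" "\<tau> 1 = 1" "bij \<tau>"
    "\<tau> (ratfun_const c) = ratfun_const c"
    "\<tau> (- f) = - \<tau> f" "\<tau> (inverse f) = inverse (\<tau> f)"
proof -
  have add: "\<tau> (f + g) = \<tau> f + \<tau> g" and mult: "\<tau> (f * g) = \<tau> f * \<tau> g" for f g
    using assms by (auto simp: ratfun_automorphism_def ring_iso_def ring_hom_def
        ring_of_type_algebra_def)
  show "\<tau> (f + g) = \<tau> f + \<tau> g" "\<tau> (f * g) = \<tau> f * \<tau> g"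
    by (fact add mult)+
  show one: "\<tau> 1 = 1" and "bij \<tau>"
    using assms by (auto simp: ratfun_automorphism_def ring_iso_def ring_hom_def
        ring_of_type_algebra_def)
  have const: "\<tau> (ratfun_const c) = ratfun_const c" for c
    using assms by (simp add: ratfun_automorphism_def)
  show "\<tau> (ratfun_const c) = ratfun_const c" by (fact const)
  from const[of 0] show zero: "\<tau> 0 = 0" by simp
  show "\<tau> (- f) = - \<tau> f"
    using add[of f "- f"] zero by (simp add: eq_neg_iff_add_eq_0 add.commute)
  show "\<tau> (inverse f) = inverse (\<tau> f)"
  proof (cases "f = 0")
    case False
    hence "\<tau> f * \<tau> (inverse f) = 1"
      using mult[of f "inverse f"] one by simp
    thus ?thesis by (metis inverse_unique)
  qed (simp add: zero)
qed

lemma ratfun_automorphism_poly: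
  assumes "ratfun_automorphism \<tau>"
  shows "\<tau> (to_fract p) = poly (map_poly ratfun_const p) (\<tau> ratfun_X)"
  unfolding ratfun_poly_X[symmetric]
  by (induction p) (simp_all add: ratfun_poly_pCons ratfun_automorphismD[OF assms])

lemma ratfun_automorphism_unique:
  assumes "ratfun_automorphism \<tau>" "ratfun_automorphism \<tau>'" "\<tau> ratfun_X = \<tau>' ratfun_X"
  shows "\<tau> = \<tau>'"
proof
  fix f
  show "\<tau> f = \<tau>' f"
    by (cases f) (simp add: Fract_conv_to_fract divide_inverse ratfun_automorphismD[OF assms(1)]
      ratfun_automorphismD[OF assms(2)] ratfun_automorphism_poly[OF assms(1)]
      ratfun_automorphism_poly[OF assms(2)] assms(3))
qed

lemma ratfun_automorphism_exists:
  fixes c :: "'k::field"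
  assumes "c \<noteq> 0"
  shows "\<exists>!\<tau>. ratfun_automorphism \<tau> \<and> \<tau> ratfun_X = ratfun_const c / ratfun_X"
proof -
  define g :: "'k ratfun" where "g = ratfun_const c / ratfun_X"
  define ev where "ev p = poly (map_poly ratfun_const p) g" for p
  have ev_add: "ev (p + q) = ev p + ev q" and ev_mult: "ev (p * q) = ev p * ev q" for p q
    by (simp_all add: ev_def ratfun_poly_add ratfun_poly_mult)
  have ev_0: "p \<noteq> 0 \<Longrightarrow> ev p \<noteq> 0" for p
    using ratfun_poly_inverse_X_nonzero[OF assms] by (simp add: ev_def g_def)
  have ev_const: "ev [:d:] = ratfun_const d" for d
    by (simp add: ev_def map_poly_pCons)
  have ev_X: "ev [:0, 1:] = g"
    by (simp add: ev_def map_poly_pCons)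
  define \<tau> where "\<tau> f = (SOME y. \<exists>p q. q \<noteq> 0 \<and> f = Fract p q \<and> y = ev p / ev q)" for f
  have \<tau>: "\<tau> (Fract p q) = ev p / ev q" if "q \<noteq> 0" for p q
  proof -
    have "\<exists>p' q'. q' \<noteq> 0 \<and> Fract p q = Fract p' q' \<and> \<tau> (Fract p q) = ev p' / ev q'"
      unfolding \<tau>_def by (rule someI_ex) (use that in blast)
    then obtain p' q' where *: "q' \<noteq> 0" "Fract p q = Fract p' q'"
      "\<tau> (Fract p q) = ev p' / ev q'" by blast
    have "p * q' = p' * q" using * that by (simp add: eq_fract)
    hence "ev p * ev q' = ev p' * ev q" by (metis ev_mult)
    thus ?thesis using * that ev_0 by (simp add: frac_eq_eq)
  qed
  have ev1: "ev 1 = 1" using ev_const[of 1] by (simp flip: one_pCons)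
  have tf: "\<tau> (to_fract p) = ev p" for p
    by (simp add: to_fract_def \<tau> ev1)
  have add: "\<tau> (x + y) = \<tau> x + \<tau> y" for x y
    by (cases x, cases y) (simp add: \<tau> ev_add ev_mult ev_0 field_simps)
  have mult: "\<tau> (x * y) = \<tau> x * \<tau> y" for x y
    by (cases x, cases y) (simp add: \<tau> ev_mult)
  have const: "\<tau> (ratfun_const d) = ratfun_const d" for d
    by (simp add: ratfun_const_def tf ev_const[unfolded ratfun_const_def])
  have X: "\<tau> ratfun_X = g" by (simp add: ratfun_X_def tf ev_X)
  have zero: "\<tau> 0 = 0" and one: "\<tau> 1 = 1" using const[of 0] const[of 1] by simp_all
  have inv: "\<tau> (inverse x) = inverse (\<tau> x)" for x
  proof (cases "x = 0")
    case False
    hence "\<tau> x * \<tau> (inverse x) = 1" using mult[of x "inverse x"] one by simp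
    thus ?thesis by (metis inverse_unique)
  qed (simp add: zero)
  have gg: "\<tau> g = ratfun_X"
    using assms by (simp add: g_def divide_inverse mult inv const X[unfolded g_def])
  have invol_poly: "\<tau> (ev p) = to_fract p" for p
    unfolding ratfun_poly_X[symmetric] ev_def
    by (induction p) (simp_all add: ratfun_poly_pCons add mult const gg zero)
  have invol: "\<tau> (\<tau> x) = x" for x
    by (cases x) (simp add: Fract_conv_to_fract tf divide_inverse mult inv invol_poly)
  have "bij \<tau>"
    using invol by (rule involuntory_imp_bij)
  hence "ratfun_automorphism \<tau>"
    by (simp add: ratfun_automorphism_def ring_iso_def ring_hom_def ring_of_type_algebra_def
        add mult one const)
  thus ?thesis
    using X unfolding g_def
    by (intro ex1I[of _ \<tau>]) (auto intro: ratfun_automorphism_unique)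
qed

lemma subfield_fixed_field:
  assumes "ratfun_automorphism \<tau>"
  shows "subfield (fixed_field \<tau>) ratfun_ring"
proof -
  interpret field "ratfun_ring :: 'a ratfun ring" by (rule field_from_type_algebra)
  note D = ratfun_automorphismD[OF assms]
  have inv_eq: "inv\<^bsub>ratfun_ring\<^esub> x = inverse x" if "x \<noteq> 0" for x :: "'a ratfun"
    by (rule comm_inv_char) (use that in \<open>simp_all add: ring_of_type_algebra_def\<close>)
  have neg_eq: "\<ominus>\<^bsub>ratfun_ring\<^esub> x = - x" for x :: "'a ratfun"
    by (rule minus_equality) (simp_all add: ring_of_type_algebra_def)
  show ?thesis
  proof (intro subfieldI' subringI)
    fix x assume "x \<in> fixed_field \<tau> - {\<zero>\<^bsub>ratfun_ring\<^esub>}"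
    hence "x \<in> fixed_field \<tau>" "x \<noteq> 0" by (auto simp: ring_of_type_algebra_def)
    thus "inv\<^bsub>ratfun_ring\<^esub> x \<in> fixed_field \<tau>"
      by (simp add: inv_eq fixed_field_def D)
  qed (auto simp: neg_eq fixed_field_def D, auto simp: ring_of_type_algebra_def D)
qed

end

theory Submission
  imports Defs
begin

text \<open>
  An element \<open>f\<close> fixed by both involutions is fixed by \<open>\<sigma> \<circ> \<sigma>\<^sub>a\<close>, which sends \<open>x\<close> to \<open>a x\<close>.
  Writing \<open>f = p / q\<close> and comparing leading coefficients in \<open>p(a x) q(x) = p(x) q(a x)\<close> gives
  \<open>a ^ deg p = a ^ deg q\<close>, so every nonzero \<open>f\<close> invariant under \<open>x \<mapsto> a x\<close> has numerator and
  denominator of equal degree. Subtracting from \<open>f\<close> the quotient of the leading coefficients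
  lowers the degree of the numerator only, so the difference is zero.

  For the index, an involution \<open>\<tau>\<close> moving \<open>x\<close> admits the basis \<open>1, x\<close>:
  \<open>f = u + v x\<close> with \<open>v = (f - \<tau> f) / (x - \<tau> x)\<close>, in every characteristic.
\<close>

lemma ratfun_automorphism_diff:
  assumes "ratfun_automorphism \<tau>"
  shows "\<tau> (f - g) = \<tau> f - \<tau> g"
  using ratfun_automorphismD(1)[OF assms, of f "- g"] ratfun_automorphismD(7)[OF assms, of g]
  by simp

lemma ratfun_automorphism_divide:
  assumes "ratfun_automorphism \<tau>"
  shows "\<tau> (f / g) = \<tau> f / \<tau> g"
  by (simp add: divide_inverse ratfun_automorphismD[OF assms])

lemma ratfun_automorphism_comp:
  assumes "ratfun_automorphism \<tau>" "ratfun_automorphism \<tau>'"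
  shows "ratfun_automorphism (\<tau> \<circ> \<tau>')"
  using assms ratfun_automorphismD(5)[OF assms(1)] ratfun_automorphismD(5)[OF assms(2)]
  by (auto simp: ratfun_automorphism_def ring_iso_def ring_hom_def ring_of_type_algebra_def
      intro: bij_comp)

lemma ratfun_automorphism_id: "ratfun_automorphism id"
  by (simp add: ratfun_automorphism_def ring_iso_def ring_hom_def ring_of_type_algebra_def)

text \<open>Otherwise \<open>x * x\<close> would be constant, which the degree forbids. Taking
  \<open>c = 1\<close> and \<open>c = a\<close> shows that both involutions move
  \<open>x\<close>.\<close>

lemma ratfun_X_ne_const_divide_X:
  "(ratfun_X :: 'k::field ratfun) \<noteq> ratfun_const c / ratfun_X"
proof
  assume "(ratfun_X :: 'k ratfun) = ratfun_const c / ratfun_X"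
  hence "(ratfun_X :: 'k ratfun) * ratfun_X = ratfun_const c"
    by (simp add: field_simps)
  hence "([:0, 1:] * [:0, 1:] :: 'k poly) = [:c:]"
    by (simp add: ratfun_X_def ratfun_const_def flip: to_fract_mult)
  thus False by simp
qed

text \<open>Automorphisms over \<open>k\<close> are determined by their value at \<open>x\<close>,
  and \<open>c / (c / x) = x\<close> because constants are fixed.\<close>

lemma inverting_automorphism_involution:
  fixes \<tau> :: "'k::field ratfun \<Rightarrow> 'k ratfun"
  assumes \<tau>: "ratfun_automorphism \<tau>" and c: "c \<noteq> 0" and X: "\<tau> ratfun_X = ratfun_const c / ratfun_X"
  shows "\<tau> \<circ> \<tau> = id"
proof (rule ratfun_automorphism_unique)
  show "ratfun_automorphism (\<tau> \<circ> \<tau>)" "ratfun_automorphism (id :: 'k ratfun \<Rightarrow> _)"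
    using \<tau> by (simp_all add: ratfun_automorphism_comp ratfun_automorphism_id)
  show "(\<tau> \<circ> \<tau>) ratfun_X = id ratfun_X"
    using c by (simp add: X ratfun_automorphism_divide[OF \<tau>] ratfun_automorphismD(6)[OF \<tau>])
qed

lemma dimension_fixed_field_involution:
  fixes \<tau> :: "'k::field ratfun \<Rightarrow> 'k ratfun"
  assumes \<tau>: "ratfun_automorphism \<tau>" and invol: "\<tau> \<circ> \<tau> = id" and moved: "\<tau> g \<noteq> g"
  shows "ring.dimension ratfun_ring 2 (fixed_field \<tau>) (carrier ratfun_ring)"
proof -
  interpret R: field "ratfun_ring :: 'k ratfun ring" by (rule field_from_type_algebra)
  let ?R = "ratfun_ring :: 'k ratfun ring"
  let ?K = "fixed_field \<tau>"
  have ops: "x \<otimes>\<^bsub>?R\<^esub> y = x * y" "x \<oplus>\<^bsub>?R\<^esub> y = x + y" "\<zero>\<^bsub>?R\<^esub> = 0" "carrier ?R = UNIV" for x y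
    by (simp_all add: ring_of_type_algebra_def)
  have line: "R.line_extension ?K v E = {k * v + e | k e. k \<in> ?K \<and> e \<in> E}" for v E
    unfolding set_eq_iff R.line_extension_mem_iff ops by blast
  note D = ratfun_automorphismD[OF \<tau>] ratfun_automorphism_diff[OF \<tau>]
    ratfun_automorphism_divide[OF \<tau>]
  have inv: "\<tau> (\<tau> f) = f" for f
    using invol by (metis comp_apply id_apply)
  \<comment> \<open>The whole field is built from the zero space by adjoining \<open>1\<close>,
    whose span is the fixed field, and then \<open>g\<close>, which lies outside that span because
    \<open>\<tau>\<close> moves it.\<close>
  have dim0: "R.dimension 0 ?K {0}"
    using R.zero_dim[of ?K] by (simp add: ops)
  have line1: "R.line_extension ?K 1 {0} = ?K"
    by (auto simp: line)
  have "R.dimension (Suc 0) ?K (R.line_extension ?K 1 {0})"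
    by (rule R.Suc_dim[OF _ _ dim0]) (simp_all add: ops)
  hence dim1: "R.dimension (Suc 0) ?K ?K"
    by (simp only: line1)
  have "R.dimension (Suc (Suc 0)) ?K (R.line_extension ?K g ?K)"
    by (rule R.Suc_dim[OF _ _ dim1]) (use moved in \<open>simp_all add: ops fixed_field_def\<close>)
  moreover have "R.line_extension ?K g ?K = carrier ?R"
  proof -
    have "f \<in> R.line_extension ?K g ?K" for f
    proof -
      \<comment> \<open>If \<open>f = u + v * g\<close> with \<open>u\<close> and \<open>v\<close>
        fixed, then \<open>\<tau> f = u + v * \<tau> g\<close>; subtracting forces this value of
        \<open>v\<close>.\<close>
      define v where "v = (f - \<tau> f) / (g - \<tau> g)"
      \<comment> \<open>The involution swaps the terms of each difference, so both signs change and
        the quotient stays fixed.\<close>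
      have "\<tau> v = (- (f - \<tau> f)) / (- (g - \<tau> g))"
        by (simp add: v_def D inv)
      hence v: "\<tau> v = v"
        by (simp only: v_def minus_divide_divide)
      have "v * (g - \<tau> g) = f - \<tau> f"
        using moved by (simp add: v_def)
      hence "\<tau> (f - v * g) = f - v * g"
        by (simp add: D v algebra_simps)
      hence "v \<in> ?K" "f - v * g \<in> ?K" "f = v * g + (f - v * g)"
        using v by (simp_all add: fixed_field_def)
      thus ?thesis unfolding line by blast
    qed
    thus ?thesis by (auto simp: ops)
  qed
  ultimately show ?thesis by (simp add: numeral_2_eq_2)
qed

text \<open>Cancelling the smaller power would leave a positive power of \<open>a\<close> equal to
  \<open>1\<close>.\<close>

lemma power_inj_of_infinite_order:
  fixes a :: "'k::field"
  assumes "a \<noteq> 0" "\<forall>n::nat. n > 0 \<longrightarrow> a ^ n \<noteq> 1" "a ^ m = a ^ n"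
  shows "m = n"
proof -
  have "\<not> i < j" if "a ^ i = a ^ j" for i j
  proof
    assume "i < j"
    hence "a ^ j = a ^ i * a ^ (j - i)" by (simp flip: power_add)
    hence "a ^ (j - i) = 1" using that assms(1) by simp
    thus False using assms(2) \<open>i < j\<close> by simp
  qed
  thus ?thesis using assms(3) by (metis linorder_neqE_nat)
qed

lemma degree_eq_of_scaling_invariant:
  fixes p q :: "'k::field poly"
  assumes a: "a \<noteq> 0" "\<forall>n::nat. n > 0 \<longrightarrow> a ^ n \<noteq> 1"
    and nz: "p \<noteq> 0" "q \<noteq> 0"
    and eq: "pcompose p [:0, a:] * q = p * pcompose q [:0, a:]"
  shows "degree p = degree q"
proof -
  \<comment> \<open>Since \<open>a\<close> is nonzero, replacing \<open>x\<close> by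
    \<open>a x\<close> preserves the degree.\<close>
  have lead: "lead_coeff (pcompose r [:0, a:]) = lead_coeff r * a ^ degree r" for r
    using a(1) by (subst lead_coeff_comp) simp_all
  have "lead_coeff (pcompose p [:0, a:] * q) = lead_coeff (p * pcompose q [:0, a:])"
    by (simp only: eq)
  hence "a ^ degree p = a ^ degree q"
    unfolding lead_coeff_mult lead using nz by simp
  thus ?thesis using power_inj_of_infinite_order a by blast
qed

lemma scaling_invariant_imp_const:
  fixes \<tau> :: "'k::field ratfun \<Rightarrow> 'k ratfun"
  assumes a: "a \<noteq> 0" "\<forall>n::nat. n > 0 \<longrightarrow> a ^ n \<noteq> 1"
    and \<tau>: "ratfun_automorphism \<tau>" and X: "\<tau> ratfun_X = ratfun_const a * ratfun_X"
    and fixed: "\<tau> f = f"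
  shows "f \<in> range ratfun_const"
proof -
  note D = ratfun_automorphismD[OF \<tau>] ratfun_automorphism_diff[OF \<tau>]
    ratfun_automorphism_divide[OF \<tau>]
  have \<tau>_poly: "\<tau> (to_fract p) = to_fract (pcompose p [:0, a:])" for p
    by (simp add: ratfun_automorphism_poly[OF \<tau>] X ratfun_poly_scaled_X)
  have deg: "degree p = degree q" if "p \<noteq> 0" "q \<noteq> 0" "\<tau> (to_fract p / to_fract q) = to_fract p / to_fract q" for p q
  proof (rule degree_eq_of_scaling_invariant[OF a that(1,2)])
    have "pcompose q [:0, a:] \<noteq> 0"
      using that(2) a(1) by (subst pcompose_eq_0_iff) auto
    hence "to_fract (pcompose p [:0, a:]) * to_fract q = to_fract p * to_fract (pcompose q [:0, a:])"
      using that by (simp add: D \<tau>_poly frac_eq_eq)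
    thus "pcompose p [:0, a:] * q = p * pcompose q [:0, a:]"
      by (simp flip: to_fract_mult)
  qed
  obtain p q where f: "f = to_fract p / to_fract q" and q: "q \<noteq> 0"
    by (cases f) (auto simp: Fract_conv_to_fract)
  \<comment> \<open>Reading the coefficient of \<open>p\<close> at \<open>degree q\<close>, not at
    \<open>degree p\<close>, makes the coefficient of \<open>r\<close> there vanish whatever the
    degree of \<open>p\<close>, so \<open>f = 0\<close> needs no separate case.\<close>
  define c where "c = coeff p (degree q) / lead_coeff q"
  define r where "r = p - smult c q"
  have "to_fract (smult c q) = ratfun_const c * to_fract q"
    by (simp add: ratfun_const_def flip: to_fract_mult)
  hence fc: "f - ratfun_const c = to_fract r / to_fract q"
    using q by (simp add: f r_def field_simps)
  have "r = 0"
  proof (rule ccontr)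
    assume "r \<noteq> 0"
    have "\<tau> (f - ratfun_const c) = f - ratfun_const c"
      by (simp add: D fixed)
    hence "degree r = degree q"
      using deg[OF \<open>r \<noteq> 0\<close> q] by (simp only: fc)
    moreover have "coeff r (degree q) = 0"
      using q by (simp add: r_def c_def)
    ultimately show False using \<open>r \<noteq> 0\<close> by (metis leading_coeff_0_iff)
  qed
  hence "f = ratfun_const c" using fc by simp
  thus ?thesis by blast
qed

theorem mainTheorem3:
  fixes a :: "'k::alg_closed_field"
    and \<sigma> \<sigma>\<^sub>a :: "'k ratfun \<Rightarrow> 'k ratfun"
  assumes "a \<noteq> 0"
    and "\<forall>n::nat. n > 0 \<longrightarrow> a ^ n \<noteq> 1"
    and "ratfun_automorphism \<sigma>" and "\<sigma> ratfun_X = 1 / ratfun_X"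
    and "ratfun_automorphism \<sigma>\<^sub>a" and "\<sigma>\<^sub>a ratfun_X = ratfun_const a / ratfun_X"
  shows "\<sigma> \<noteq> id \<and> \<sigma> \<circ> \<sigma> = id \<and> \<sigma>\<^sub>a \<noteq> id \<and> \<sigma>\<^sub>a \<circ> \<sigma>\<^sub>a = id
    \<and> ring.dimension ratfun_ring 2 (fixed_field \<sigma>) (carrier ratfun_ring)
    \<and> ring.dimension ratfun_ring 2 (fixed_field \<sigma>\<^sub>a) (carrier ratfun_ring)
    \<and> fixed_field \<sigma> \<inter> fixed_field \<sigma>\<^sub>a = range ratfun_const"
proof -
  have X1: "\<sigma> ratfun_X = ratfun_const 1 / ratfun_X"
    by (simp add: assms(4))
  have moved: "\<sigma> ratfun_X \<noteq> ratfun_X" "\<sigma>\<^sub>a ratfun_X \<noteq> ratfun_X"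
    unfolding X1 assms(6) using ratfun_X_ne_const_divide_X by metis+
  have invol: "\<sigma> \<circ> \<sigma> = id" "\<sigma>\<^sub>a \<circ> \<sigma>\<^sub>a = id"
    using inverting_automorphism_involution[OF assms(3) _ X1]
      inverting_automorphism_involution[OF assms(5,1,6)] by simp_all
  have dim: "ring.dimension ratfun_ring 2 (fixed_field \<sigma>) (carrier ratfun_ring)"
    "ring.dimension ratfun_ring 2 (fixed_field \<sigma>\<^sub>a) (carrier ratfun_ring)"
    using dimension_fixed_field_involution assms(3,5) invol moved by blast+
  \<comment> \<open>Constants are fixed, so \<open>\<sigma>\<close> sends \<open>a / x\<close> to
    \<open>a / (1 / x) = a x\<close>.\<close>
  have scale: "(\<sigma> \<circ> \<sigma>\<^sub>a) ratfun_X = ratfun_const a * ratfun_X"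
    by (simp add: assms(4,6) ratfun_automorphism_divide[OF assms(3)]
        ratfun_automorphismD(6)[OF assms(3)])
  have "fixed_field \<sigma> \<inter> fixed_field \<sigma>\<^sub>a \<subseteq> range ratfun_const"
  proof
    fix f assume "f \<in> fixed_field \<sigma> \<inter> fixed_field \<sigma>\<^sub>a"
    hence "(\<sigma> \<circ> \<sigma>\<^sub>a) f = f" by (simp add: fixed_field_def)
    with assms(1,2) ratfun_automorphism_comp[OF assms(3,5)] scale
    show "f \<in> range ratfun_const" by (rule scaling_invariant_imp_const)
  qed
  moreover have "range ratfun_const \<subseteq> fixed_field \<sigma> \<inter> fixed_field \<sigma>\<^sub>a"
    by (auto simp: fixed_field_def ratfun_automorphismD(6)[OF assms(3)]
        ratfun_automorphismD(6)[OF assms(5)])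
  ultimately show ?thesis using moved invol dim by auto
qed

end
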